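(* Let $n\ge1$ and let $\mathcal{B}=(G,\theta)$ be the valued digraph defined as follows. Its vertex set is $\lambda_n^s=\{(a,b)\in[\pm n]^2: a<b,\ |a|\le b\}$. For $(a,b)\in\lambda_n^s$ let $\widetilde H(a,b)=\{(a,b)\}\cup\{(x,y)\in\lambda_n^s:\exists k\in[\pm n],\ a<k<b,\ (x,y)\in\{(k,b),(a,k),(-k,-a)\}\}$; there is an arc from $\mathfrak{c}$ to $\mathfrak{d}$ iff $\mathfrak{c}\ne\mathfrak{d}$ and $\mathfrak{d}\in\widetilde H(\mathfrak{c})$; and $\theta(\mathfrak{c})=d^+(\mathfrak{c})/2$. Then $(B_n,\le_R)$ is isomorphic to $(IS(\mathcal{B}),\subseteq)$.
   Context: $[\pm n]=\{-n,\dots,-1,1,\dots,n\}$. $B_n$ is the Coxeter group with generators $s_0,s_1,\dots,s_{n-1}$, realized as the group of signed permutations $\omega$ of $[\pm n]$ (bijections with $\omega(-m)=-\omega(m)$), where $s_0$ exchanges $1$ and $-1$ and $s_i$ ($i\ge1$) exchanges $i,i+1$ (and $-i,-i-1$). With $\ell$ the Coxeter length, the right weak order is $w\le_R\tau$ iff $\tau=ws_{j_1}\cdots s_{j_k}$ with $\ell(\tau)=\ell(w)+k$. Valued digraph: pair $(G,\theta)$, $G=(V,E)$ simple acyclic digraph, $\theta:V\to\mathbb{N}$ with $0\le\theta(x)\le d^+(x)$ (out-degree). A vertex $x$ is erasable if $\theta(x)=0$ and every $z$ with $(z,x)\in E$ has $\theta(z)\ne0$. Peeling process: repeatedly choose an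 erasable vertex $x_i$ of the current valued digraph, delete it with its incident arcs, and decrease by $1$ the value of each $y$ with an arc $(y,x_i)$; stop when no erasable vertex remains. $IS(\mathcal{G})$ consists of $\emptyset$ and all sets $\{x_1,\dots,x_k\}$ ($k\ge1$) formed by the first $k$ entries of a peeling sequence. *)

theory Defs
  imports "Graph_Theory.Pair_Digraph" "HOL-Combinatorics.Permutations"
begin

definition pm_interval :: "nat \<Rightarrow> int set" where
  "pm_interval n = {- int n..int n} - {0}"

text \<open>A signed permutation is extended by the identity outside \<^term>\<open>pm_interval n\<close>.\<close>

definition signed_perms :: "nat \<Rightarrow> (int \<Rightarrow> int) set" where
  "signed_perms n = {w. w permutes pm_interval n \<and> (\<forall>m\<in>pm_interval n. w (- m) = - w m)}"

definition simple_refl :: "nat \<Rightarrow> int \<Rightarrow> int" where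
  "simple_refl i =
     (if i = 0 then transpose 1 (- 1)
      else transpose (int i) (int i + 1) \<circ> transpose (- int i) (- int i - 1))"

definition word_prod :: "nat list \<Rightarrow> int \<Rightarrow> int" where
  "word_prod js = foldr (\<lambda>j w. simple_refl j \<circ> w) js id"

definition cox_length :: "nat \<Rightarrow> (int \<Rightarrow> int) \<Rightarrow> nat" where
  "cox_length n w = (LEAST k. \<exists>js. set js \<subseteq> {..<n} \<and> length js = k \<and> word_prod js = w)"

definition right_weak_le :: "nat \<Rightarrow> (int \<Rightarrow> int) \<Rightarrow> (int \<Rightarrow> int) \<Rightarrow> bool" where
  "right_weak_le n w \<tau> \<longleftrightarrow>
     (\<exists>js. set js \<subseteq> {..<n} \<and> \<tau> = w \<circ> word_prod js \<and> cox_length n \<tau> = cox_length n w + length js)"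

locale valued_digraph = digraph G for G :: "('a, 'b) pre_digraph" +
  fixes \<theta> :: "'a \<Rightarrow> nat"
  assumes acyclic_arcs: "acyclic (arcs_ends G)"
    and val_le_out_degree: "x \<in> verts G \<Longrightarrow> \<theta> x \<le> out_degree G x"

definition erasable :: "('a, 'b) pre_digraph \<Rightarrow> ('a \<Rightarrow> nat) \<Rightarrow> 'a \<Rightarrow> bool" where
  "erasable G \<theta> x \<longleftrightarrow> x \<in> verts G \<and> \<theta> x = 0 \<and> (\<forall>z. z \<rightarrow>\<^bsub>G\<^esub> x \<longrightarrow> \<theta> z \<noteq> 0)"

text \<open>The truncated subtraction is only ever applied to nonzero values when \<open>x\<close> is erasable.\<close>

definition peel_val :: "('a, 'b) pre_digraph \<Rightarrow> ('a \<Rightarrow> nat) \<Rightarrow> 'a \<Rightarrow> 'a \<Rightarrow> nat" where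
  "peel_val G \<theta> x = (\<lambda>y. if y \<rightarrow>\<^bsub>G\<^esub> x then \<theta> y - 1 else \<theta> y)"

text \<open>A list is a peeling sequence only if the process has come to a halt after its last entry.
  Digraphs are finite here, so every run of the process does halt.\<close>

inductive peeling_seq :: "('a, 'b) pre_digraph \<Rightarrow> ('a \<Rightarrow> nat) \<Rightarrow> 'a list \<Rightarrow> bool" where
  stop: "(\<nexists>x. erasable G \<theta> x) \<Longrightarrow> peeling_seq G \<theta> []"
| peel: "erasable G \<theta> x \<Longrightarrow> peeling_seq (pre_digraph.del_vert G x) (peel_val G \<theta> x) xs \<Longrightarrow>
         peeling_seq G \<theta> (x # xs)"

definition IS :: "('a, 'b) pre_digraph \<Rightarrow> ('a \<Rightarrow> nat) \<Rightarrow> 'a set set" where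
  "IS G \<theta> = {{}} \<union> {set (take k xs) |k xs. peeling_seq G \<theta> xs \<and> 1 \<le> k \<and> k \<le> length xs}"

definition shifted_shape :: "nat \<Rightarrow> (int \<times> int) set" where
  "shifted_shape n = {(a, b). a \<in> pm_interval n \<and> b \<in> pm_interval n \<and> a < b \<and> \<bar>a\<bar> \<le> b}"

definition hook :: "nat \<Rightarrow> int \<times> int \<Rightarrow> (int \<times> int) set" where
  "hook n = (\<lambda>(a, b). {(a, b)} \<union>
     {(x, y) \<in> shifted_shape n.
        \<exists>k\<in>pm_interval n. a < k \<and> k < b \<and> (x, y) \<in> {(k, b), (a, k), (- k, - a)}})"

definition B_digraph :: "nat \<Rightarrow> (int \<times> int, (int \<times> int) \<times> (int \<times> int)) pre_digraph" where
  "B_digraph n = with_proj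
     \<lparr>pverts = shifted_shape n,
      parcs = {(c, d). c \<in> shifted_shape n \<and> d \<in> shifted_shape n \<and> c \<noteq> d \<and> d \<in> hook n c}\<rparr>"

text \<open>The division is exact, see \<open>even_out_degree_B\<close> below.\<close>

definition B_val :: "nat \<Rightarrow> int \<times> int \<Rightarrow> nat" where
  "B_val n c = out_degree (B_digraph n) c div 2"

lemma finite_pm_interval: "finite (pm_interval n)"
  by (simp add: pm_interval_def)

lemma finite_shifted_shape: "finite (shifted_shape n)"
  by (rule finite_subset[of _ "pm_interval n \<times> pm_interval n"])
     (auto simp: shifted_shape_def finite_pm_interval)

lemma B_arcs_width_less:
  assumes "(c, d) \<in> arcs_ends (B_digraph n)"
  shows "snd d - fst d < snd c - fst c"
  using assms by (auto simp: B_digraph_def hook_def)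

lemma valued_digraph_B: "valued_digraph (B_digraph n) (B_val n)"
proof -
  let ?P = "\<lparr>pverts = shifted_shape n,
      parcs = {(c, d). c \<in> shifted_shape n \<and> d \<in> shifted_shape n \<and> c \<noteq> d \<and> d \<in> hook n c}\<rparr>"
  have "finite {(c, d). c \<in> shifted_shape n \<and> d \<in> shifted_shape n \<and> c \<noteq> d \<and> d \<in> hook n c}"
    by (rule finite_subset[of _ "shifted_shape n \<times> shifted_shape n"])
       (auto simp: finite_shifted_shape)
  then interpret P: pair_digraph ?P
    by unfold_locales (auto simp: finite_shifted_shape)
  interpret digraph "B_digraph n"
    unfolding B_digraph_def by (rule P.digraph_axioms)
  show ?thesis
  proof
    show "acyclic (arcs_ends (B_digraph n))"
    proof (rule acyclic_subset)
      show "arcs_ends (B_digraph n) \<subseteq> (measure (\<lambda>c. nat (snd c - fst c)))\<inverse>"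
      proof
        fix e assume e: "e \<in> arcs_ends (B_digraph n)"
        obtain c d where [simp]: "e = (c, d)" by (cases e)
        from e have "d \<in> shifted_shape n" by (auto simp: B_digraph_def)
        then have "fst d < snd d" by (auto simp: shifted_shape_def)
        with B_arcs_width_less[of c d n] e
        show "e \<in> (measure (\<lambda>c. nat (snd c - fst c)))\<inverse>" by auto
      qed
      show "acyclic ((measure (\<lambda>c::int \<times> int. nat (snd c - fst c)))\<inverse>)"
        by (simp add: wf_acyclic)
    qed
  qed (simp add: B_val_def)
qed

lemma out_degree_B:
  assumes "c \<in> shifted_shape n"
  shows "out_degree (B_digraph n) c = card (hook n c \<inter> shifted_shape n - {c})"
proof -
  have "out_arcs (B_digraph n) c = Pair c ` (hook n c \<inter> shifted_shape n - {c})"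
    using assms by (auto simp: out_arcs_def B_digraph_def)
  then show ?thesis
    by (simp add: out_degree_def card_image inj_on_def)
qed

lemma even_out_degree_B:
  assumes "c \<in> shifted_shape n"
  shows "even (out_degree (B_digraph n) c)"
proof -
  obtain a b where c: "c = (a, b)" by (cases c)
  have ab: "a < b" "\<bar>a\<bar> \<le> b" "a \<noteq> 0" "b \<le> int n" "- int n \<le> a"
    using assms by (auto simp: c shifted_shape_def pm_interval_def)
  define A where "A = (\<lambda>k. (k, b)) ` ({a<..<b} - {0})"
  define C where "C = Pair a ` {k. \<bar>a\<bar> \<le> k \<and> a < k \<and> k < b}"
  define D where "D = (\<lambda>k. (k, - a)) ` ({a<..< - a} - {0})"
  have eq: "hook n c \<inter> shifted_shape n - {c} = A \<union> (C \<union> (if - a < b then D else {}))" (is "?L = ?R")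
  proof
    show "?L \<subseteq> ?R"
    proof
      fix e assume e: "e \<in> ?L"
      obtain x y where xy: "e = (x, y)" by (cases e)
      from e obtain k where k: "k \<noteq> 0" "a < k" "k < b" "x < y" "\<bar>x\<bar> \<le> y"
        and "(x, y) = (k, b) \<or> (x, y) = (a, k) \<or> (x, y) = (- k, - a)"
        by (auto simp: xy c hook_def shifted_shape_def pm_interval_def)
      then consider "x = k" "y = b" | "x = a" "y = k" | "x = - k" "y = - a" by auto
      then show "e \<in> ?R"
      proof cases
        case 1 then show ?thesis using k by (auto simp: xy A_def)
      next
        case 2 then show ?thesis using k by (auto simp: xy C_def)
      next
        case 3
        show ?thesis
        proof (cases "k = - a")
          case True then show ?thesis using 3 k ab by (auto simp: xy C_def)
        next
          case False
          show ?thesis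
          proof (cases "- a < b")
            case True
            then show ?thesis using 3 k False by (auto simp: xy D_def)
          next
            case False
            then show ?thesis using 3 k ab by (auto simp: xy A_def)
          qed
        qed
      qed
    qed
    have "A \<subseteq> ?L"
      using ab by (auto simp: A_def c hook_def shifted_shape_def pm_interval_def)
    moreover have "C \<subseteq> ?L"
      using ab by (auto simp: C_def c hook_def shifted_shape_def pm_interval_def)
    moreover have "D \<subseteq> ?L" if "- a < b"
    proof
      fix e assume "e \<in> D"
      then obtain k where "k \<in> {a<..< - a} - {0}" "e = (k, - a)"
        unfolding D_def by (rule imageE)
      then have k: "e = (k, - a)" "a < k" "k < - a" "k \<noteq> 0" by simp_all
      then have "- k \<in> pm_interval n" "a < - k" "- k < b"
        using ab that by (auto simp: pm_interval_def)
      moreover have "(k, - a) \<in> shifted_shape n"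
        using k ab by (auto simp: shifted_shape_def pm_interval_def)
      moreover have "(k, - a) = (- (- k), - a)" by simp
      ultimately have "e \<in> hook n c"
        unfolding hook_def c k(1) by blast
      with \<open>(k, - a) \<in> shifted_shape n\<close> k show "e \<in> ?L" by (auto simp: c)
    qed
    ultimately show "?R \<subseteq> ?L" by auto
  qed
  have cA: "card A = card ({a<..<b} - {0})"
    unfolding A_def by (rule card_image) (auto simp: inj_on_def)
  have cC: "card C = card {k. \<bar>a\<bar> \<le> k \<and> a < k \<and> k < b}"
    unfolding C_def by (rule card_image) (auto simp: inj_on_def)
  have cD: "card D = card ({a<..< - a} - {0})"
    unfolding D_def by (rule card_image) (auto simp: inj_on_def)
  have fin: "finite A" "finite C" "finite D"
    by (auto simp: A_def C_def D_def intro: finite_subset[of _ "{a<..<b}"])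
  have "A \<inter> C = {}" "C \<inter> D = {}" by (auto simp: A_def C_def D_def)
  moreover have "A \<inter> D = {}" if "- a < b" using that by (auto simp: A_def D_def)
  ultimately have card_eq:
    "card (A \<union> (C \<union> (if - a < b then D else {}))) = card A + (card C + (if - a < b then card D else 0))"
    using fin by (simp add: card_Un_disjoint Int_Un_distrib)
  have "even (card A + (card C + (if - a < b then card D else 0)))"
  proof (cases "0 < a")
    case True
    then have "{a<..<b} - {0} = {a<..<b}" "{k. \<bar>a\<bar> \<le> k \<and> a < k \<and> k < b} = {a<..<b}"
      "{a<..< - a} - {0} = {}" by auto
    then have "card A = card {a<..<b}" "card C = card {a<..<b}" "card D = 0"
      by (simp_all only: cA cC cD card.empty)
    then show ?thesis by simp
  next
    case False
    with ab have neg: "a < 0" "0 < b" by auto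
    then have "{k. \<bar>a\<bar> \<le> k \<and> a < k \<and> k < b} = {- a..<b}" by auto
    with neg have "card A = nat (b - a - 1) - 1" "card C = nat (b + a)" "card D = nat (- a - a - 1) - 1"
      by (simp_all add: cA cC cD card_Diff_singleton)
    with neg ab have "int (card A) = b - a - 2" "int (card C) = b + a" "int (card D) = 2 * (- a - 1)"
      by (auto simp: of_nat_diff)
    then have "int (card A + (card C + (if - a < b then card D else 0))) =
        2 * (b - 1 + (if - a < b then - a - 1 else 0))"
      by auto
    then show ?thesis by presburger
  qed
  then show ?thesis
    using out_degree_B[OF assms] by (simp only: eq card_eq)
qed

end

theory Submission
  imports Defs
begin

text \<open>
  The isomorphism sends \<open>w\<close> to the set of pairs of values \<open>a < b\<close> that \<open>w\<close> places in the wrong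
  order.  Half of the neighbours of a non-inversion \<open>(a, b)\<close> are inversions exactly if no value
  between \<open>a\<close> and \<open>b\<close> is placed between them, and the condition on the predecessors excludes the
  remaining values; so from the inversion set of \<open>w\<close> the erasable vertices are exactly the pairs at
  neighbouring positions, and erasing one multiplies \<open>w\<close> on the right by a simple reflection.  Since
  the length is the number of inversions, and a proper inclusion of inversion sets can always be
  refined by such a step, inclusion is the right weak order.
\<close>

section \<open>Signed permutations\<close>

lemma pm_interval_iff: "x \<in> pm_interval n \<longleftrightarrow> x \<noteq> 0 \<and> - int n \<le> x \<and> x \<le> int n"
  by (auto simp: pm_interval_def)

lemma pm_interval_uminus: "- x \<in> pm_interval n \<longleftrightarrow> x \<in> pm_interval n"
  by (auto simp: pm_interval_iff)

lemma signed_perms_permutes: "w \<in> signed_perms n \<Longrightarrow> w permutes pm_interval n"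
  by (simp add: signed_perms_def)

text \<open>Outside \<open>pm_interval n\<close> the permutation is the identity, hence odd as well.
  Stated for all integers, the rule can be applied without a membership condition.\<close>

lemma signed_perms_odd:
  assumes "w \<in> signed_perms n"
  shows "w (- m) = - w m"
proof (cases "m \<in> pm_interval n")
  case False
  then have "- m \<notin> pm_interval n" by (simp add: pm_interval_uminus)
  with False show ?thesis
    using permutes_not_in[OF signed_perms_permutes[OF assms]] by simp
qed (use assms in \<open>simp add: signed_perms_def\<close>)

lemma signed_perms_mem_iff:
  "w \<in> signed_perms n \<Longrightarrow> w m \<in> pm_interval n \<longleftrightarrow> m \<in> pm_interval n"
  by (rule permutes_in_image[OF signed_perms_permutes])

lemma signed_perms_eq_iff: "w \<in> signed_perms n \<Longrightarrow> w x = w y \<longleftrightarrow> x = y"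
  using permutes_inj signed_perms_permutes by (metis injD)

lemma signed_perms_inv_apply [simp]:
  assumes "w \<in> signed_perms n"
  shows "inv w (w x) = x" "w (inv w x) = x"
  using permutes_inverses[OF signed_perms_permutes[OF assms]] by simp_all

lemma id_in_signed_perms: "id \<in> signed_perms n"
  by (simp add: signed_perms_def permutes_id)

lemma comp_in_signed_perms:
  "u \<in> signed_perms n \<Longrightarrow> w \<in> signed_perms n \<Longrightarrow> u \<circ> w \<in> signed_perms n"
  by (auto simp: signed_perms_def permutes_compose permutes_in_image)

lemma inv_in_signed_perms:
  assumes "w \<in> signed_perms n"
  shows "inv w \<in> signed_perms n"
proof -
  have "inv w (- m) = - inv w m" for m
  proof -
    have "w (- inv w m) = - m" using assms by (simp add: signed_perms_odd[OF assms])
    then show ?thesis using signed_perms_inv_apply(1)[OF assms] by metis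
  qed
  then show ?thesis
    using permutes_inv[OF signed_perms_permutes[OF assms]] by (simp add: signed_perms_def)
qed

text \<open>The generator \<open>simple_refl i\<close> exchanges the neighbouring positions
  \<open>lower_pos i\<close> and \<open>int i + 1\<close> of \<open>[\<plusminus>n]\<close>, uniformly in \<open>i \<ge> 0\<close>.\<close>

definition lower_pos :: "nat \<Rightarrow> int" where
  "lower_pos i = (if i = 0 then - 1 else int i)"

lemma simple_refl_apply:
  "simple_refl i x =
     (if x = lower_pos i then int i + 1 else if x = int i + 1 then lower_pos i
      else if x = - lower_pos i then - (int i + 1) else if x = - (int i + 1) then - lower_pos i
      else x)"
  by (auto simp: simple_refl_def lower_pos_def transpose_def)

lemma simple_refl_simple_refl [simp]: "simple_refl i (simple_refl i x) = x"
  by (auto simp: simple_refl_apply lower_pos_def)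

lemma simple_refl_comp_self: "simple_refl i \<circ> simple_refl i = id"
  by auto

lemma lower_pos_mem: "i < n \<Longrightarrow> lower_pos i \<in> pm_interval n" "i < n \<Longrightarrow> int i + 1 \<in> pm_interval n"
  by (auto simp: lower_pos_def pm_interval_iff)

lemma simple_refl_in_signed_perms:
  assumes "i < n"
  shows "simple_refl i \<in> signed_perms n"
proof -
  have "bij (simple_refl i)"
    by (rule o_bij[OF simple_refl_comp_self simple_refl_comp_self])
  then have "simple_refl i permutes pm_interval n"
    using assms unfolding permutes_def bij_iff
    by (auto simp: simple_refl_apply lower_pos_def pm_interval_iff)
  moreover have "simple_refl i (- m) = - simple_refl i m" for m
    by (auto simp: simple_refl_apply lower_pos_def)
  ultimately show ?thesis by (simp add: signed_perms_def)
qed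

lemma word_prod_Nil [simp]: "word_prod [] = id"
  by (simp add: word_prod_def)

lemma word_prod_Cons [simp]: "word_prod (j # js) = simple_refl j \<circ> word_prod js"
  by (simp add: word_prod_def)

text \<open>Without a descent the values at the positions \<open>-1, 1, 2, ..., n\<close> increase.
  By oddness the first inequality makes \<open>u 1\<close> positive, and an increasing map of
  \<open>{1..n}\<close> into itself is the identity.\<close>

lemma signed_perm_descent:
  assumes u: "u \<in> signed_perms n" and "u \<noteq> id"
  shows "\<exists>i<n. u (int i + 1) < u (lower_pos i)"
proof (rule ccontr)
  assume "\<not> ?thesis"
  then have asc: "u (lower_pos i) < u (int i + 1)" if "i < n" for i
    using that signed_perms_eq_iff[OF u, of "lower_pos i" "int i + 1"]
    by (fastforce simp: lower_pos_def split: if_splits)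
  have lo: "int i + 1 \<le> u (int i + 1)" if "i < n" for i
    using that
  proof (induction i)
    case 0
    then show ?case using asc[of 0] signed_perms_odd[OF u, of 1] by (simp add: lower_pos_def)
  next
    case (Suc i)
    then show ?case using asc[of "Suc i"] by (simp add: lower_pos_def algebra_simps)
  qed
  \<comment> \<open>The matching upper bound runs down from position \<open>n\<close>, where it is
    just membership in \<open>pm_interval n\<close>.\<close>
  have hi: "u (int n - int k) \<le> int n - int k" if "k < n" for k
    using that
  proof (induction k)
    case 0
    then show ?case
      using signed_perms_mem_iff[OF u, of "int n"] by (auto simp: pm_interval_iff)
  next
    case (Suc k)
    define i where "i = n - Suc k"
    have i: "i < n" "0 < i" "int n - int (Suc k) = int i" "int n - int k = int i + 1"
      using Suc.prems by (auto simp: i_def of_nat_diff)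
    then show ?case
      using Suc.IH Suc.prems asc[of i] unfolding i(3,4) by (simp add: lower_pos_def)
  qed
  have pos: "u x = x" if "0 < x" "x \<le> int n" for x
  proof -
    have "u x \<ge> x" using lo[of "nat (x - 1)"] that by simp
    moreover have "u x \<le> x" using hi[of "nat (int n - x)"] that by simp
    ultimately show ?thesis by simp
  qed
  have "u x = x" for x
  proof (cases "x \<in> pm_interval n")
    case True
    then consider "0 < x" "x \<le> int n" | "0 < - x" "- x \<le> int n"
      by (cases "0 < x") (auto simp: pm_interval_iff)
    then show ?thesis
      using pos[of x] pos[of "- x"] signed_perms_odd[OF u, of x] by cases auto
  next
    case False
    then show ?thesis using permutes_not_in[OF signed_perms_permutes[OF u]] by simp
  qed
  with \<open>u \<noteq> id\<close> show False by auto
qed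

section \<open>Inversion sets\<close>

text \<open>The cells of the shifted shape represent the pairs \<open>a < b\<close> in \<open>[\<plusminus>n]\<close>
  modulo \<open>(a, b) \<sim> (-b, -a)\<close>.\<close>

definition shift_rep :: "int \<Rightarrow> int \<Rightarrow> int \<times> int" where
  "shift_rep a b = (if - b \<le> a then (a, b) else (- b, - a))"

lemma shift_rep_mem:
  "a \<in> pm_interval n \<Longrightarrow> b \<in> pm_interval n \<Longrightarrow> a < b \<Longrightarrow> shift_rep a b \<in> shifted_shape n"
  by (auto simp: shift_rep_def shifted_shape_def pm_interval_iff)

lemma shift_rep_shape: "(a, b) \<in> shifted_shape n \<Longrightarrow> shift_rep a b = (a, b)"
  by (auto simp: shift_rep_def shifted_shape_def)

lemma shift_rep_flip: "shift_rep (- b) (- a) = shift_rep a b"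
  by (auto simp: shift_rep_def)

lemma shape_eq_shift_rep_iff:
  "(x, y) \<in> shifted_shape n \<Longrightarrow> a < b \<Longrightarrow>
     (x, y) = shift_rep a b \<longleftrightarrow> x = a \<and> y = b \<or> x = - b \<and> y = - a"
  by (auto simp: shift_rep_def shifted_shape_def)

text \<open>Inversions are recorded by values, not by positions: multiplying on the right by a
  generator then leaves all other recorded pairs in place.\<close>

definition Linv :: "nat \<Rightarrow> (int \<Rightarrow> int) \<Rightarrow> (int \<times> int) set" where
  "Linv n w = {(a, b) \<in> shifted_shape n. inv w b < inv w a}"

lemma Linv_subset: "Linv n w \<subseteq> shifted_shape n"
  by (auto simp: Linv_def)

lemma finite_Linv: "finite (Linv n w)"
  by (rule finite_subset[OF Linv_subset finite_shifted_shape])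

lemma Linv_id: "Linv n id = {}"
  by (auto simp: Linv_def shifted_shape_def)

lemma shift_rep_in_Linv_iff:
  assumes "w \<in> signed_perms n" "a \<in> pm_interval n" "b \<in> pm_interval n" "a < b"
  shows "shift_rep a b \<in> Linv n w \<longleftrightarrow> inv w b < inv w a"
  using shift_rep_mem[OF assms(2-4)] signed_perms_odd[OF inv_in_signed_perms[OF assms(1)]]
  by (auto simp: Linv_def shift_rep_def)

text \<open>A generator reverses the order only of the pair of neighbouring positions that it
  exchanges and of the negated pair, which coincide for \<open>i = 0\<close>. The position 0 must be
  excluded: for \<open>i = 0\<close> it lies between the exchanged positions.\<close>

lemma simple_refl_less_iff:
  assumes "p \<noteq> q" "p \<noteq> 0" "q \<noteq> 0"
  shows "simple_refl i q < simple_refl i p \<longleftrightarrow>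
    (q < p \<and> \<not> (p = int i + 1 \<and> q = lower_pos i) \<and> \<not> (p = - lower_pos i \<and> q = - (int i + 1))) \<or>
    (p = lower_pos i \<and> q = int i + 1) \<or> (p = - (int i + 1) \<and> q = - lower_pos i)"
  using assms by (cases "i = 0") (auto simp: simple_refl_apply lower_pos_def)

text \<open>Only the values at the two exchanged positions and their negatives change their relative
  order, and these two pairs are represented by one cell.\<close>

lemma Linv_comp_simple_refl:
  assumes w: "w \<in> signed_perms n" and i: "i < n" and asc: "w (lower_pos i) < w (int i + 1)"
  defines "c \<equiv> shift_rep (w (lower_pos i)) (w (int i + 1))"
  shows "Linv n (w \<circ> simple_refl i) = insert c (Linv n w)" "c \<notin> Linv n w"
proof -
  let ?a = "w (lower_pos i)" and ?b = "w (int i + 1)"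
  have mem: "?a \<in> pm_interval n" "?b \<in> pm_interval n"
    using lower_pos_mem[OF i] signed_perms_mem_iff[OF w] by auto
  have "lower_pos i < int i + 1" by (simp add: lower_pos_def)
  then show "c \<notin> Linv n w"
    unfolding c_def using shift_rep_in_Linv_iff[OF w mem asc] w by simp
  have inv: "inv (w \<circ> simple_refl i) = simple_refl i \<circ> inv w"
    using w by (intro inv_unique_comp) (auto simp: fun_eq_iff)
  have "(x, y) \<in> Linv n (w \<circ> simple_refl i) \<longleftrightarrow> (x, y) = c \<or> (x, y) \<in> Linv n w"
    if xy: "(x, y) \<in> shifted_shape n" for x y
  proof -
    define p q where "p = inv w x" and "q = inv w y"
    have x: "x = w p" and y: "y = w q" using w by (simp_all add: p_def q_def)
    have "x < y" "x \<in> pm_interval n" "y \<in> pm_interval n" using xy by (auto simp: shifted_shape_def)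
    then have pq: "p \<in> pm_interval n" "q \<in> pm_interval n" "p \<noteq> q"
      using signed_perms_mem_iff[OF w] by (auto simp: x y)
    have "w (- int i - 1) = - w (int i + 1)" using signed_perms_odd[OF w, of "int i + 1"] by simp
    \<comment> \<open>These are the cases in which the reflection would undo an inversion; both
      would force \<open>y < x\<close>.\<close>
    then have no: "\<not> (p = int i + 1 \<and> q = lower_pos i)" "\<not> (p = - lower_pos i \<and> q = - (int i + 1))"
      using \<open>x < y\<close> asc by (auto simp: x y signed_perms_odd[OF w])
    have eq: "(x, y) = c \<longleftrightarrow>
      (p = lower_pos i \<and> q = int i + 1) \<or> (p = - (int i + 1) \<and> q = - lower_pos i)"
      unfolding c_def shape_eq_shift_rep_iff[OF xy asc]
      by (simp add: x y signed_perms_odd[OF w, symmetric] signed_perms_eq_iff[OF w])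
    show ?thesis
      using xy simple_refl_less_iff[of p q i] pq no
      by (auto simp: Linv_def inv eq simp flip: p_def q_def simp: pm_interval_iff)
  qed
  moreover have "c \<in> shifted_shape n"
    unfolding c_def by (rule shift_rep_mem[OF mem asc])
  ultimately have "e \<in> Linv n (w \<circ> simple_refl i) \<longleftrightarrow> e = c \<or> e \<in> Linv n w" for e
    using subsetD[OF Linv_subset, of e n] by (cases e, cases "e \<in> shifted_shape n") blast+
  then show "Linv n (w \<circ> simple_refl i) = insert c (Linv n w)" by blast
qed

text \<open>A descent of \<open>w\<close> is an ascent of \<open>w \<circ> simple_refl i\<close>,
  and a second multiplication by the generator leads back to \<open>w\<close>.\<close>

lemma Linv_comp_simple_refl_descent:
  assumes w: "w \<in> signed_perms n" and i: "i < n" and desc: "w (int i + 1) < w (lower_pos i)"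
  shows "\<exists>c. Linv n w = insert c (Linv n (w \<circ> simple_refl i)) \<and> c \<notin> Linv n (w \<circ> simple_refl i)"
proof -
  let ?v = "w \<circ> simple_refl i"
  have v: "?v \<in> signed_perms n"
    by (intro comp_in_signed_perms simple_refl_in_signed_perms w i)
  have "?v (lower_pos i) < ?v (int i + 1)"
    using desc by (simp add: simple_refl_apply) (simp add: lower_pos_def)
  from Linv_comp_simple_refl[OF v i this] show ?thesis
    unfolding comp_assoc simple_refl_comp_self comp_id by blast
qed

text \<open>A descent \<open>i\<close> of \<open>inv \<tau> \<circ> w\<close> marks neighbouring
  positions of \<open>w\<close> whose values stand in the opposite order in \<open>\<tau>\<close>.
  They ascend in \<open>w\<close>, since otherwise they would form an inversion of \<open>w\<close>
  that \<open>\<tau>\<close> does not have.\<close>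

lemma Linv_extend:
  assumes w: "w \<in> signed_perms n" and t: "\<tau> \<in> signed_perms n"
    and sub: "Linv n w \<subseteq> Linv n \<tau>" and "w \<noteq> \<tau>"
  obtains i where "i < n" "w (lower_pos i) < w (int i + 1)"
    "shift_rep (w (lower_pos i)) (w (int i + 1)) \<in> Linv n \<tau>"
proof -
  let ?u = "inv \<tau> \<circ> w"
  have "?u \<in> signed_perms n"
    by (intro comp_in_signed_perms inv_in_signed_perms w t)
  moreover have "?u \<noteq> id"
    using \<open>w \<noteq> \<tau>\<close> signed_perms_inv_apply(2)[OF t] by (metis comp_apply ext id_apply)
  ultimately obtain i where i: "i < n" and d: "?u (int i + 1) < ?u (lower_pos i)"
    using signed_perm_descent by blast
  let ?a = "w (lower_pos i)" and ?b = "w (int i + 1)"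
  have mem: "?a \<in> pm_interval n" "?b \<in> pm_interval n"
    using lower_pos_mem[OF i] signed_perms_mem_iff[OF w] by auto
  have lt: "lower_pos i < int i + 1" by (simp add: lower_pos_def)
  have asc: "?a < ?b"
  proof (rule ccontr)
    assume "\<not> ?a < ?b"
    then have "?b < ?a" using signed_perms_eq_iff[OF w, of "lower_pos i" "int i + 1"] lt by auto
    then have "shift_rep ?b ?a \<in> Linv n w"
      using shift_rep_in_Linv_iff[OF w mem(2,1)] w lt by simp
    then show False
      using sub shift_rep_in_Linv_iff[OF t mem(2,1) \<open>?b < ?a\<close>] d by auto
  qed
  with d i show ?thesis
    by (intro that[of i]) (auto simp: shift_rep_in_Linv_iff[OF t mem])
qed

lemma Linv_inj:
  assumes w: "w \<in> signed_perms n" and t: "\<tau> \<in> signed_perms n" and eq: "Linv n w = Linv n \<tau>"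
  shows "w = \<tau>"
proof (rule ccontr)
  assume "w \<noteq> \<tau>"
  from Linv_extend[OF w t _ this] eq obtain i where
    "i < n" "w (lower_pos i) < w (int i + 1)"
    "shift_rep (w (lower_pos i)) (w (int i + 1)) \<in> Linv n w"
    by auto
  with Linv_comp_simple_refl(2)[OF w] show False by blast
qed

section \<open>Length and right weak order in terms of inversion sets\<close>

text \<open>Repeated use of \<open>Linv_extend\<close> climbs from \<open>w\<close> to
  \<open>\<tau>\<close>; each letter adds exactly one inversion.\<close>

lemma Linv_subset_word:
  assumes "w \<in> signed_perms n" "\<tau> \<in> signed_perms n" "Linv n w \<subseteq> Linv n \<tau>"
  shows "\<exists>js. set js \<subseteq> {..<n} \<and> \<tau> = w \<circ> word_prod js \<and> card (Linv n \<tau>) = card (Linv n w) + length js"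
  using assms
proof (induction "card (Linv n \<tau> - Linv n w)" arbitrary: w rule: less_induct)
  case less
  show ?case
  proof (cases "w = \<tau>")
    case True
    then show ?thesis by (intro exI[of _ "[]"]) simp
  next
    case False
    from Linv_extend[OF less.prems False] obtain i where i: "i < n" "w (lower_pos i) < w (int i + 1)"
      and c: "shift_rep (w (lower_pos i)) (w (int i + 1)) \<in> Linv n \<tau>" .
    note st = Linv_comp_simple_refl[OF less.prems(1) i]
    let ?v = "w \<circ> simple_refl i"
    have v: "?v \<in> signed_perms n"
      by (intro comp_in_signed_perms simple_refl_in_signed_perms less.prems i)
    have sub: "Linv n ?v \<subseteq> Linv n \<tau>" using st c less.prems by auto
    have "card (Linv n \<tau> - Linv n ?v) < card (Linv n \<tau> - Linv n w)"
      by (rule psubset_card_mono) (use st c finite_Linv in auto)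
    from less.hyps[OF this v less.prems(2) sub] obtain js where
      "set js \<subseteq> {..<n}" "\<tau> = ?v \<circ> word_prod js" "card (Linv n \<tau>) = card (Linv n ?v) + length js"
      by blast
    then show ?thesis
      using i st finite_Linv[of n w] by (intro exI[of _ "i # js"]) (auto simp: comp_assoc)
  qed
qed

text \<open>Each letter adds or removes one inversion. If the count grows by the full length of the
  word, every letter adds one, so no inversion is ever lost.\<close>

lemma Linv_comp_word_prod:
  assumes "w \<in> signed_perms n" "set js \<subseteq> {..<n}"
  shows "card (Linv n (w \<circ> word_prod js)) \<le> card (Linv n w) + length js \<and>
    (card (Linv n (w \<circ> word_prod js)) = card (Linv n w) + length js \<longrightarrow>
       Linv n w \<subseteq> Linv n (w \<circ> word_prod js))"
  using assms
proof (induction js arbitrary: w)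
  case (Cons j js)
  define v where "v = w \<circ> simple_refl j"
  define u where "u = v \<circ> word_prod js"
  have j: "j < n" and js: "set js \<subseteq> {..<n}" using Cons.prems by simp_all
  have v: "v \<in> signed_perms n"
    unfolding v_def by (intro comp_in_signed_perms simple_refl_in_signed_perms Cons.prems j)
  have IH: "card (Linv n u) \<le> card (Linv n v) + length js"
    "card (Linv n u) = card (Linv n v) + length js \<longrightarrow> Linv n v \<subseteq> Linv n u"
    unfolding u_def using Cons.IH[OF v js] by blast+
  have eq: "w \<circ> word_prod (j # js) = u" by (simp add: u_def v_def comp_assoc)
  have "w (lower_pos j) \<noteq> w (int j + 1)"
    using signed_perms_eq_iff[OF Cons.prems(1)] by (simp add: lower_pos_def)
  then consider "w (lower_pos j) < w (int j + 1)" | "w (int j + 1) < w (lower_pos j)"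
    by linarith
  then show ?case
  proof cases
    case 1
    note st = Linv_comp_simple_refl[OF Cons.prems(1) j 1, folded v_def]
    then have "card (Linv n v) = Suc (card (Linv n w))" "Linv n w \<subseteq> Linv n v"
      using finite_Linv[of n w] by auto
    then show ?thesis unfolding eq using IH by auto
  next
    case 2
    obtain c where "Linv n w = insert c (Linv n v)" "c \<notin> Linv n v"
      using Linv_comp_simple_refl_descent[OF Cons.prems(1) j 2] unfolding v_def by blast
    then have "card (Linv n w) = Suc (card (Linv n v))"
      using finite_Linv[of n v] by simp
    then show ?thesis unfolding eq using IH(1) by auto
  qed
qed simp

text \<open>Starting from \<open>id\<close>, whose inversion set is empty, the two preceding lemmas
  give a word of this length and the lower bound for all words.\<close>

lemma cox_length_eq_card_Linv:
  assumes "w \<in> signed_perms n"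
  shows "cox_length n w = card (Linv n w)"
  unfolding cox_length_def
proof (rule Least_equality)
  show "\<exists>js. set js \<subseteq> {..<n} \<and> length js = card (Linv n w) \<and> word_prod js = w"
    using Linv_subset_word[OF id_in_signed_perms assms] by (auto simp: Linv_id)
  show "card (Linv n w) \<le> k" if "\<exists>js. set js \<subseteq> {..<n} \<and> length js = k \<and> word_prod js = w" for k
    using that Linv_comp_word_prod[OF id_in_signed_perms] by (force simp: Linv_id)
qed

lemma right_weak_le_iff_Linv_subset:
  assumes w: "w \<in> signed_perms n" and t: "\<tau> \<in> signed_perms n"
  shows "right_weak_le n w \<tau> \<longleftrightarrow> Linv n w \<subseteq> Linv n \<tau>"
  unfolding right_weak_le_def cox_length_eq_card_Linv[OF w] cox_length_eq_card_Linv[OF t]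
  using Linv_comp_word_prod[OF w] Linv_subset_word[OF w t] by blast

section \<open>Erasable vertices\<close>

definition B_nbrs :: "nat \<Rightarrow> int \<times> int \<Rightarrow> (int \<times> int) set" where
  "B_nbrs n c = hook n c \<inter> shifted_shape n - {c}"

lemma B_dominates_iff: "c \<rightarrow>\<^bsub>B_digraph n\<^esub> d \<longleftrightarrow> c \<in> shifted_shape n \<and> d \<in> B_nbrs n c"
  by (auto simp: B_digraph_def B_nbrs_def)

lemma verts_B [simp]: "verts (B_digraph n) = shifted_shape n"
  by (simp add: B_digraph_def)

lemma B_val_eq: "c \<in> shifted_shape n \<Longrightarrow> B_val n c = card (B_nbrs n c) div 2"
  by (simp add: B_val_def out_degree_B B_nbrs_def)

lemma even_card_B_nbrs: "c \<in> shifted_shape n \<Longrightarrow> even (card (B_nbrs n c))"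
  using even_out_degree_B[of c n] by (simp add: out_degree_B B_nbrs_def)

definition between :: "nat \<Rightarrow> int \<Rightarrow> int \<Rightarrow> int set" where
  "between n a b = {k \<in> pm_interval n. a < k \<and> k < b}"

lemma between_uminus: "between n (- b) (- a) = uminus ` between n a b"
proof (intro set_eqI iffI)
  fix k assume "k \<in> between n (- b) (- a)"
  then have "- k \<in> between n a b" by (auto simp: between_def pm_interval_uminus)
  then show "k \<in> uminus ` between n a b" by (intro image_eqI[of k uminus "- k"]) auto
qed (auto simp: between_def pm_interval_uminus)

lemma finite_between: "finite (between n a b)"
  by (simp add: between_def finite_pm_interval)

text \<open>The third family of the hook disappears because \<open>(- k, - a)\<close> and
  \<open>(a, k)\<close> stand for the same pair: the out-neighbours are the two halves of
  \<open>(a, b)\<close> split at an intermediate value.\<close>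

lemma B_nbrs_eq:
  assumes "(a, b) \<in> shifted_shape n"
  shows "B_nbrs n (a, b) =
    (\<lambda>k. shift_rep k b) ` between n a b \<union> (\<lambda>k. shift_rep a k) ` between n a b"
proof (intro set_eqI iffI)
  fix e assume e: "e \<in> B_nbrs n (a, b)"
  then obtain k where "k \<in> between n a b" "e \<in> shifted_shape n"
    "e = (k, b) \<or> e = (a, k) \<or> e = (- k, - a)"
    by (auto simp: B_nbrs_def hook_def between_def)
  then show "e \<in> (\<lambda>k. shift_rep k b) ` between n a b \<union> (\<lambda>k. shift_rep a k) ` between n a b"
    by (metis (no_types, lifting) UnI1 UnI2 image_eqI shift_rep_shape shift_rep_flip)
next
  fix e assume "e \<in> (\<lambda>k. shift_rep k b) ` between n a b \<union> (\<lambda>k. shift_rep a k) ` between n a b"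
  then obtain k where k: "k \<in> between n a b" "e = shift_rep k b \<or> e = shift_rep a k" by auto
  have "a \<in> pm_interval n" "b \<in> pm_interval n" using assms by (auto simp: shifted_shape_def)
  then have "shift_rep k b \<in> shifted_shape n" "shift_rep a k \<in> shifted_shape n"
    using k(1) by (auto simp: between_def intro: shift_rep_mem)
  then have "e \<in> shifted_shape n" using k(2) by auto
  moreover have "e = (k, b) \<or> e = (a, k) \<or> e = (- k, - a)" "e \<noteq> (a, b)"
    using k assms by (auto simp: shift_rep_def between_def shifted_shape_def split: if_splits)
  moreover have "k \<in> pm_interval n" "a < k" "k < b" using k by (auto simp: between_def)
  ultimately show "e \<in> B_nbrs n (a, b)"
    unfolding B_nbrs_def hook_def by blast
qed

lemma finite_B_nbrs: "finite (B_nbrs n c)"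
  by (auto simp: B_nbrs_def finite_shifted_shape)

lemma shift_rep_B_nbrs:
  assumes "a \<in> pm_interval n" "b \<in> pm_interval n" "k \<in> between n a b"
  shows "shift_rep k b \<in> B_nbrs n (shift_rep a b)" "shift_rep a k \<in> B_nbrs n (shift_rep a b)"
proof -
  have k: "k \<in> between n a b" "- k \<in> between n (- b) (- a)" and ab: "a < b"
    using assms by (auto simp: between_def pm_interval_uminus)
  have "shift_rep a b \<in> shifted_shape n" using assms ab by (intro shift_rep_mem)
  then have "shift_rep a b = (a, b) \<and> (a, b) \<in> shifted_shape n \<or>
    shift_rep a b = (- b, - a) \<and> (- b, - a) \<in> shifted_shape n"
    by (metis shift_rep_def)
  then have "shift_rep k b \<in> B_nbrs n (shift_rep a b) \<and> shift_rep a k \<in> B_nbrs n (shift_rep a b)"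
  proof
    assume "shift_rep a b = (a, b) \<and> (a, b) \<in> shifted_shape n"
    then show ?thesis using k(1) by (auto simp: B_nbrs_eq)
  next
    assume *: "shift_rep a b = (- b, - a) \<and> (- b, - a) \<in> shifted_shape n"
    have "shift_rep (- b) (- k) \<in> B_nbrs n (- b, - a)" "shift_rep (- k) (- a) \<in> B_nbrs n (- b, - a)"
      using k(2) * by (auto simp: B_nbrs_eq)
    then show ?thesis using * by (simp add: shift_rep_flip)
  qed
  then show "shift_rep k b \<in> B_nbrs n (shift_rep a b)" "shift_rep a k \<in> B_nbrs n (shift_rep a b)"
    by auto
qed

text \<open>Of the two neighbours \<open>(a, k)\<close> and \<open>(k, b)\<close> of a non-inversion \<open>(a, b)\<close> at most one is an
  inversion, so at most half of the neighbours are; for \<open>b = -a\<close> the pairs of \<open>k\<close> and \<open>-k\<close> coincide.\<close>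

lemma B_val_le_iff:
  assumes w: "w \<in> signed_perms n" and ab: "(a, b) \<in> shifted_shape n" "(a, b) \<notin> Linv n w"
  shows "B_val n (a, b) \<le> card (B_nbrs n (a, b) \<inter> Linv n w) \<longleftrightarrow>
    (\<forall>k\<in>between n a b. \<not> (inv w a < inv w k \<and> inv w k < inv w b))"
proof -
  let ?p = "inv w"
  let ?K = "between n a b"
  have ab': "a \<in> pm_interval n" "b \<in> pm_interval n" "a < b" "- b \<le> a"
    using ab by (auto simp: shifted_shape_def)
  have p: "?p \<in> signed_perms n" by (rule inv_in_signed_perms[OF w])
  have pab: "?p a < ?p b"
    using ab ab' signed_perms_eq_iff[OF p, of a b] by (auto simp: Linv_def)
  \<comment> \<open>\<open>U\<close> indexes the inversions among the pairs \<open>(k, b)\<close>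
    and \<open>D\<close> those among the pairs \<open>(a, k)\<close>. An intermediate value outside
    both is placed between \<open>a\<close> and \<open>b\<close>.\<close>
  define U where "U = {k\<in>?K. ?p b < ?p k}"
  define D where "D = {k\<in>?K. ?p k < ?p a}"
  have fin: "finite U" "finite D" "finite ?K" by (auto simp: U_def D_def finite_between)
  have dis: "U \<inter> D = {}" using pab by (auto simp: U_def D_def)
  have cardUD: "card U + card D = card (U \<union> D)"
    using card_Un_disjoint[OF fin(1,2) dis] by simp
  have sub: "U \<union> D \<subseteq> ?K" by (auto simp: U_def D_def)
  have rhs: "(\<forall>k\<in>?K. \<not> (?p a < ?p k \<and> ?p k < ?p b)) \<longleftrightarrow> card ?K \<le> card U + card D"
  proof -
    have "(\<forall>k\<in>?K. \<not> (?p a < ?p k \<and> ?p k < ?p b)) \<longleftrightarrow> U \<union> D = ?K"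
    proof -
      have ne: "?p k \<noteq> ?p a" "?p k \<noteq> ?p b" if "k \<in> ?K" for k
        using that signed_perms_eq_iff[OF p] by (auto simp: between_def)
      have "\<not> (?p a < ?p k \<and> ?p k < ?p b) \<longleftrightarrow> k \<in> U \<union> D" if "k \<in> ?K" for k
        using that ne[OF that] by (auto simp: U_def D_def not_less)
      then show ?thesis using sub by blast
    qed
    also have "\<dots> \<longleftrightarrow> card ?K \<le> card (U \<union> D)"
      using sub fin(3) card_seteq by (metis order_refl)
    finally show ?thesis by (simp add: cardUD)
  qed
  let ?l = "\<lambda>k. shift_rep k b" and ?r = "\<lambda>k. shift_rep a k"
  have lS: "?l k \<in> Linv n w \<longleftrightarrow> k \<in> U" and rS: "?r k \<in> Linv n w \<longleftrightarrow> k \<in> D" if "k \<in> ?K" for k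
    using that ab' by (auto simp: U_def D_def between_def shift_rep_in_Linv_iff[OF w])
  have injl: "inj_on ?l ?K" and injr: "inj_on ?r ?K"
    using ab' by (auto simp: inj_on_def shift_rep_def between_def split: if_splits)
  have nb: "B_nbrs n (a, b) = ?l ` ?K \<union> ?r ` ?K" by (rule B_nbrs_eq[OF ab(1)])
  have US: "U \<subseteq> ?K" and DS: "D \<subseteq> ?K" by (auto simp: U_def D_def)
  show ?thesis
  proof (cases "a = - b")
    case False
    have dj: "?l ` ?K \<inter> ?r ` ?K = {}"
      using ab' False by (auto simp: shift_rep_def between_def split: if_splits)
    have "card (B_nbrs n (a, b)) = 2 * card ?K"
      unfolding nb using fin dj by (simp add: card_Un_disjoint card_image injl injr)
    moreover have "B_nbrs n (a, b) \<inter> Linv n w = ?l ` U \<union> ?r ` D"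
      unfolding nb using lS rS US DS by auto
    moreover have "card (?l ` U \<union> ?r ` D) = card (?l ` U) + card (?r ` D)"
      using dj US DS fin by (intro card_Un_disjoint) auto
    moreover have "card (?l ` U) = card U" "card (?r ` D) = card D"
      using injl injr US DS by (auto intro!: card_image intro: inj_on_subset)
    ultimately show ?thesis
      unfolding rhs B_val_eq[OF ab(1)] by simp
  next
    case True
    \<comment> \<open>Negation now permutes the intermediate values, identifies the two families of
      neighbours and exchanges \<open>U\<close> with \<open>D\<close>. There are only
      \<open>card ?K\<close> neighbours, of which \<open>card U\<close> are inversions.\<close>
    have neg: "uminus ` ?K = ?K"
      using between_uminus[of n b a] True by simp
    have r: "?r k = ?l (- k)" for k
      using True shift_rep_flip[of b "- k"] by simp
    have "?r ` ?K = ?l ` (uminus ` ?K)" unfolding image_image r ..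
    then have nb': "B_nbrs n (a, b) = ?l ` ?K" unfolding nb neg by simp
    have "card (B_nbrs n (a, b)) = card ?K"
      unfolding nb' by (rule card_image[OF injl])
    moreover have "B_nbrs n (a, b) \<inter> Linv n w = ?l ` U"
      unfolding nb' using lS US by auto
    moreover have "card (?l ` U) = card U"
      using injl US by (auto intro!: card_image intro: inj_on_subset)
    moreover have "card D = card U"
    proof -
      have "D = uminus ` U"
      proof (intro set_eqI iffI)
        fix k assume "k \<in> D"
        then have "- k \<in> U" using True
          by (auto simp: U_def D_def between_def pm_interval_uminus signed_perms_odd[OF p])
        then show "k \<in> uminus ` U" by force
      qed (use True in \<open>auto simp: U_def D_def between_def pm_interval_uminus signed_perms_odd[OF p]\<close>)
      then show ?thesis by (simp add: card_image)
    qed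
    \<comment> \<open>Parity matters: with a rounded half, \<open>card ?K div 2 \<le> card U\<close>
      would not give \<open>card ?K \<le> 2 * card U\<close>.\<close>
    moreover note even_card_B_nbrs[OF ab(1)]
    ultimately show ?thesis
      unfolding rhs B_val_eq[OF ab(1)] by auto
  qed
qed

text \<open>This is erasability after the set \<open>S\<close> has been erased, in terms of the
  original values: the current value is \<open>B_val n c - card (B_nbrs n c \<inter> S)\<close>,
  truncated at zero.\<close>

definition erasable_at :: "nat \<Rightarrow> (int \<times> int) set \<Rightarrow> int \<times> int \<Rightarrow> bool" where
  "erasable_at n S c \<longleftrightarrow> c \<in> shifted_shape n - S \<and> B_val n c \<le> card (B_nbrs n c \<inter> S) \<and>
     (\<forall>z\<in>shifted_shape n - S. c \<in> B_nbrs n z \<longrightarrow> card (B_nbrs n z \<inter> S) < B_val n z)"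

lemma B_val_shift_rep_le_iff:
  assumes w: "w \<in> signed_perms n" and ab: "a \<in> pm_interval n" "b \<in> pm_interval n" "a < b"
    "inv w a < inv w b"
  shows "B_val n (shift_rep a b) \<le> card (B_nbrs n (shift_rep a b) \<inter> Linv n w) \<longleftrightarrow>
    (\<forall>k\<in>between n a b. \<not> (inv w a < inv w k \<and> inv w k < inv w b))"
proof -
  have mem: "shift_rep a b \<in> shifted_shape n" "shift_rep a b \<notin> Linv n w"
    using shift_rep_mem[OF ab(1-3)] shift_rep_in_Linv_iff[OF w ab(1-3)] ab(4) by auto
  show ?thesis
  proof (cases "- b \<le> a")
    case True
    then show ?thesis using B_val_le_iff[OF w] mem by (simp add: shift_rep_def)
  next
    case False
    have "(\<forall>k\<in>between n (- b) (- a). \<not> (inv w (- b) < inv w k \<and> inv w k < inv w (- a))) \<longleftrightarrow>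
      (\<forall>k\<in>between n a b. \<not> (inv w a < inv w k \<and> inv w k < inv w b))"
    proof -
      have o: "inv w (- k) = - inv w k" for k
        by (rule signed_perms_odd[OF inv_in_signed_perms[OF w]])
      show ?thesis unfolding between_uminus by (auto simp: o)
    qed
    then show ?thesis using False B_val_le_iff[OF w] mem by (simp add: shift_rep_def)
  qed
qed

text \<open>No value fits between neighbouring positions, so the vertex has value zero. A
  predecessor not yet erased extends the pair by a third value, and the old endpoint that it splits
  at lies between its endpoints in position too; hence its value is nonzero.\<close>

lemma erasable_at_ascent:
  assumes w: "w \<in> signed_perms n" and i: "i < n" and asc: "w (lower_pos i) < w (int i + 1)"
  shows "erasable_at n (Linv n w) (shift_rep (w (lower_pos i)) (w (int i + 1)))"
proof -
  let ?a = "w (lower_pos i)" and ?b = "w (int i + 1)"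
  have p: "inv w \<in> signed_perms n" by (rule inv_in_signed_perms[OF w])
  have mem: "?a \<in> pm_interval n" "?b \<in> pm_interval n"
    using lower_pos_mem[OF i] signed_perms_mem_iff[OF w] by auto
  have pos: "inv w ?a = lower_pos i" "inv w ?b = int i + 1" using w by auto
  have lt: "inv w ?a < inv w ?b" unfolding pos by (simp add: lower_pos_def)
  have gap: "\<not> (lower_pos i < q \<and> q < int i + 1)" "\<not> (- (int i + 1) < q \<and> q < - lower_pos i)"
    if "q \<in> pm_interval n" for q
    using that by (auto simp: lower_pos_def pm_interval_iff split: if_splits)
  have pm: "inv w k \<in> pm_interval n \<longleftrightarrow> k \<in> pm_interval n" for k
    by (rule signed_perms_mem_iff[OF p])
  have "B_val n (shift_rep ?a ?b) \<le> card (B_nbrs n (shift_rep ?a ?b) \<inter> Linv n w)"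
    unfolding B_val_shift_rep_le_iff[OF w mem asc lt] pos
    using gap(1) pm by (auto simp: between_def)
  moreover have "shift_rep ?a ?b \<in> shifted_shape n - Linv n w"
    using shift_rep_mem[OF mem asc] Linv_comp_simple_refl(2)[OF w i asc] by blast
  moreover have "card (B_nbrs n z \<inter> Linv n w) < B_val n z"
    if z: "z \<in> shifted_shape n - Linv n w" and c: "shift_rep ?a ?b \<in> B_nbrs n z" for z
  proof -
    obtain x y where xy: "z = (x, y)" by (cases z)
    have s: "(x, y) \<in> shifted_shape n" "(x, y) \<notin> Linv n w" using z xy by auto
    have xym: "x \<in> pm_interval n" "y \<in> pm_interval n" "x < y"
      using s by (auto simp: shifted_shape_def)
    have "inv w x < inv w y"
      using s xym signed_perms_eq_iff[OF p, of x y] by (auto simp: Linv_def)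
    from c obtain k where k: "k \<in> between n x y"
      and "shift_rep ?a ?b = shift_rep k y \<or> shift_rep ?a ?b = shift_rep x k"
      unfolding xy B_nbrs_eq[OF s(1)] by auto
    \<comment> \<open>The cell may represent the pair or its negative, and it may be either half of
      \<open>(x, y)\<close>, which makes four cases.\<close>
    then have "k = ?a \<and> y = ?b \<or> k = - ?b \<and> y = - ?a \<or> x = ?a \<and> k = ?b \<or> x = - ?b \<and> k = - ?a"
      by (auto simp: shift_rep_def split: if_splits)
    then have ends: "inv w k = lower_pos i \<and> inv w y = int i + 1 \<or>
        inv w k = - (int i + 1) \<and> inv w y = - lower_pos i \<or>
        inv w x = lower_pos i \<and> inv w k = int i + 1 \<or>
        inv w x = - (int i + 1) \<and> inv w k = - lower_pos i"
      using signed_perms_odd[OF p] pos by metis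
    have "k \<in> pm_interval n" "k \<noteq> x" "k \<noteq> y" using k by (auto simp: between_def)
    then have ne: "inv w k \<noteq> inv w x" "inv w k \<noteq> inv w y" using signed_perms_eq_iff[OF p] by auto
    have gx: "\<not> (lower_pos i < inv w x \<and> inv w x < int i + 1)"
        "\<not> (- (int i + 1) < inv w x \<and> inv w x < - lower_pos i)"
      and gy: "\<not> (lower_pos i < inv w y \<and> inv w y < int i + 1)"
        "\<not> (- (int i + 1) < inv w y \<and> inv w y < - lower_pos i)"
      using gap pm xym by blast+
    \<comment> \<open>Two of the three positions are neighbours in the right order. The third cannot
      fall into the gap, so the order of \<open>x\<close> and \<open>y\<close> puts it on the outer
      side.\<close>
    have "inv w x < inv w k \<and> inv w k < inv w y"
      using ends ne lt[unfolded pos] \<open>inv w x < inv w y\<close> gx gy by (smt (verit))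
    then show ?thesis
      using B_val_le_iff[OF w s] k xy by force
  qed
  ultimately show ?thesis by (simp add: erasable_at_def)
qed

lemma consecutive_positions:
  assumes "p \<in> pm_interval n" "q \<in> pm_interval n" "p < q"
    and gap: "\<And>r. r \<in> pm_interval n \<Longrightarrow> \<not> (p < r \<and> r < q)"
  obtains i where "i < n" "p = lower_pos i \<and> q = int i + 1 \<or> p = - (int i + 1) \<and> q = - lower_pos i"
proof -
  \<comment> \<open>The successor of \<open>-1\<close> is \<open>1\<close>, as 0 is not a
    position.\<close>
  have q: "q = (if p = - 1 then 1 else p + 1)"
    using assms(1-3) gap[of "if p = - 1 then 1 else p + 1"] by (auto simp: pm_interval_iff split: if_splits)
  consider "p = - 1" | "0 < p" | "p < - 1" using assms(1) by (force simp: pm_interval_iff)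
  then show thesis
  proof cases
    case 1
    then show ?thesis using assms q by (intro that[of 0]) (auto simp: lower_pos_def pm_interval_iff)
  next
    case 2
    then show ?thesis using assms q by (intro that[of "nat p"]) (auto simp: lower_pos_def pm_interval_iff)
  next
    case 3
    then show ?thesis using assms q by (intro that[of "nat (- q)"]) (auto simp: lower_pos_def pm_interval_iff)
  qed
qed

text \<open>If some value \<open>k\<close> sits between \<open>a\<close> and \<open>b\<close> in position but not in value, then the one closest
  in value to the interval \<open>[a, b]\<close> yields a vertex \<open>(k, b)\<close> or \<open>(a, k)\<close> of value zero that blocks
  the erasure of \<open>(a, b)\<close>.\<close>

lemma erasable_at_imp_ascent:
  assumes w: "w \<in> signed_perms n" and c: "erasable_at n (Linv n w) c"
  obtains i where "i < n" "w (lower_pos i) < w (int i + 1)"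
    "c = shift_rep (w (lower_pos i)) (w (int i + 1))"
proof -
  have p: "inv w \<in> signed_perms n" by (rule inv_in_signed_perms[OF w])
  obtain a b where cab: "c = (a, b)" by (cases c)
  have s: "(a, b) \<in> shifted_shape n" "(a, b) \<notin> Linv n w"
    and val: "B_val n (a, b) \<le> card (B_nbrs n (a, b) \<inter> Linv n w)"
    and blk: "\<And>z. z \<in> shifted_shape n \<Longrightarrow> z \<notin> Linv n w \<Longrightarrow> (a, b) \<in> B_nbrs n z \<Longrightarrow>
      \<not> B_val n z \<le> card (B_nbrs n z \<inter> Linv n w)"
    using c by (auto simp: erasable_at_def cab not_le)
  have ab: "a \<in> pm_interval n" "b \<in> pm_interval n" "a < b"
    using s by (auto simp: shifted_shape_def)
  have rep: "shift_rep a b = (a, b)" by (rule shift_rep_shape[OF s(1)])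
  have lt: "inv w a < inv w b"
    using s ab signed_perms_eq_iff[OF p, of a b] by (auto simp: Linv_def)
  have inside: "\<not> (inv w a < inv w k \<and> inv w k < inv w b)" if "k \<in> between n a b" for k
    using val that unfolding B_val_le_iff[OF w s] by blast
  have blk': "\<exists>k\<in>between n x y. inv w x < inv w k \<and> inv w k < inv w y"
    if xy: "x \<in> pm_interval n" "y \<in> pm_interval n" "x < y" "inv w x < inv w y"
      and nb: "(a, b) \<in> B_nbrs n (shift_rep x y)" for x y
    using blk[OF shift_rep_mem[OF xy(1-3)] _ nb] B_val_shift_rep_le_iff[OF w xy]
      shift_rep_in_Linv_iff[OF w xy(1-3)] xy(4) by auto
  define M where "M = {k \<in> pm_interval n. inv w a < inv w k \<and> inv w k < inv w b}"
  have finM: "finite M" by (simp add: M_def finite_pm_interval)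
  have left: False if "k \<in> M" "k < a" for k
  proof -
    define m where "m = Max {k \<in> M. k < a}"
    have "m \<in> {k \<in> M. k < a}"
      unfolding m_def by (rule Max_in) (use finM that in auto)
    then have m: "m \<in> pm_interval n" "inv w a < inv w m" "inv w m < inv w b" "m < a"
      by (auto simp: M_def)
    have max: "j \<le> m" if "j \<in> M" "j < a" for j
      unfolding m_def by (rule Max_ge) (use finM that in auto)
    have "a \<in> between n m b" using m ab by (auto simp: between_def)
    from shift_rep_B_nbrs(1)[OF m(1) ab(2) this]
    have "(a, b) \<in> B_nbrs n (shift_rep m b)" by (simp add: rep)
    \<comment> \<open>The non-inversion \<open>(m, b)\<close> precedes \<open>(a, b)\<close>, so its
      value is nonzero and some \<open>j\<close> lies between \<open>m\<close> and \<open>b\<close>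
      in both value and position. By maximality of \<open>m\<close>, \<open>j\<close> exceeds
      \<open>a\<close>, which contradicts \<open>inside\<close>.\<close>
    from blk'[OF m(1) ab(2) _ m(3) this] m ab obtain j where
      j: "j \<in> between n m b" "inv w m < inv w j" "inv w j < inv w b" by auto
    then have "j \<in> M" using m by (auto simp: M_def between_def)
    moreover have "m < j" "j < b" using j by (auto simp: between_def)
    ultimately have "\<not> j < a" "j \<noteq> a" using max[of j] by (auto simp: M_def)
    then have "j \<in> between n a b" using j by (auto simp: between_def)
    from inside[OF this] j m show False by auto
  qed
  have right: False if "k \<in> M" "b < k" for k
  proof -
    define m where "m = Min {k \<in> M. b < k}"
    have "m \<in> {k \<in> M. b < k}"
      unfolding m_def by (rule Min_in) (use finM that in auto)
    then have m: "m \<in> pm_interval n" "inv w a < inv w m" "inv w m < inv w b" "b < m"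
      by (auto simp: M_def)
    have min: "m \<le> j" if "j \<in> M" "b < j" for j
      unfolding m_def by (rule Min_le) (use finM that in auto)
    have "b \<in> between n a m" using m ab by (auto simp: between_def)
    from shift_rep_B_nbrs(2)[OF ab(1) m(1) this]
    have "(a, b) \<in> B_nbrs n (shift_rep a m)" by (simp add: rep)
    from blk'[OF ab(1) m(1) _ m(2) this] m ab obtain j where
      j: "j \<in> between n a m" "inv w a < inv w j" "inv w j < inv w m" by auto
    then have "j \<in> M" using m by (auto simp: M_def between_def)
    moreover have "a < j" "j < m" using j by (auto simp: between_def)
    ultimately have "\<not> b < j" "j \<noteq> b" using min[of j] by (auto simp: M_def)
    then have "j \<in> between n a b" using j by (auto simp: between_def)
    from inside[OF this] j m show False by auto
  qed
  have "M = {}"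
  proof (rule equals0I)
    fix k assume k: "k \<in> M"
    then have "k \<notin> between n a b" using inside by (auto simp: M_def)
    moreover have "k \<noteq> a" "k \<noteq> b" using k by (auto simp: M_def)
    ultimately show False using left[OF k] right[OF k] k by (force simp: M_def between_def)
  qed
  have "\<not> (inv w a < r \<and> r < inv w b)" if "r \<in> pm_interval n" for r
  proof -
    have "w r \<notin> M" using \<open>M = {}\<close> by simp
    then show ?thesis using that w signed_perms_mem_iff[OF w, of r] by (auto simp: M_def)
  qed
  then obtain i where i: "i < n" "inv w a = lower_pos i \<and> inv w b = int i + 1 \<or>
      inv w a = - (int i + 1) \<and> inv w b = - lower_pos i"
    using consecutive_positions[of "inv w a" n "inv w b"] ab lt signed_perms_mem_iff[OF p] by blast
  then have "a = w (lower_pos i) \<and> b = w (int i + 1) \<or>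
      a = - w (int i + 1) \<and> b = - w (lower_pos i)"
    using signed_perms_inv_apply(2)[OF w] signed_perms_odd[OF w] by metis
  then show ?thesis
    using that[OF i(1)] ab rep shift_rep_flip cab by auto
qed

section \<open>The peeling process\<close>

text \<open>\<open>(G, \<theta>)\<close> is what remains of the valued digraph after erasing the set \<open>S\<close>.  Truncation is
  harmless here since \<open>(x - m) - 1 = x - (m + 1)\<close> holds for truncated subtraction as well.\<close>

definition peeled :: "nat \<Rightarrow> (int \<times> int) set \<Rightarrow> (int \<times> int, 'b) pre_digraph \<Rightarrow> (int \<times> int \<Rightarrow> nat) \<Rightarrow> bool"
  where "peeled n S G \<theta> \<longleftrightarrow> verts G = shifted_shape n - S \<and>
    (\<forall>x y. x \<rightarrow>\<^bsub>G\<^esub> y \<longleftrightarrow> x \<in> verts G \<and> y \<in> verts G \<and> y \<in> B_nbrs n x) \<and>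
    (\<forall>x\<in>verts G. \<theta> x = B_val n x - card (B_nbrs n x \<inter> S))"

lemma peeled_B: "peeled n {} (B_digraph n) (B_val n)"
  by (auto simp: peeled_def B_dominates_iff) (auto simp: B_nbrs_def)

lemma dominates_del_vert:
  "x \<rightarrow>\<^bsub>pre_digraph.del_vert G v\<^esub> y \<longleftrightarrow> x \<rightarrow>\<^bsub>G\<^esub> y \<and> x \<noteq> v \<and> y \<noteq> v"
  by (auto simp: arcs_ends_def arc_to_ends_def pre_digraph.del_vert_def image_iff)

text \<open>Since \<open>x\<close> is not yet in \<open>S\<close>, the count of erased neighbours
  grows by one exactly at the predecessors of \<open>x\<close>, where \<open>peel_val\<close>
  subtracts one.\<close>

lemma peeled_peel:
  assumes "peeled n S G \<theta>" "x \<in> verts G"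
  shows "peeled n (insert x S) (pre_digraph.del_vert G x) (peel_val G \<theta> x)"
proof -
  have G: "verts G = shifted_shape n - S"
    "\<And>x y. x \<rightarrow>\<^bsub>G\<^esub> y \<longleftrightarrow> x \<in> verts G \<and> y \<in> verts G \<and> y \<in> B_nbrs n x"
    "\<And>x. x \<in> verts G \<Longrightarrow> \<theta> x = B_val n x - card (B_nbrs n x \<inter> S)"
    using assms by (auto simp: peeled_def)
  have v: "verts (pre_digraph.del_vert G x) = verts G - {x}"
    by (simp add: pre_digraph.del_vert_def)
  have "peel_val G \<theta> x y = B_val n y - card (B_nbrs n y \<inter> insert x S)" if "y \<in> verts G" for y
    using that G assms(2) finite_B_nbrs[of n y] by (auto simp: peel_val_def)
  then show ?thesis
    unfolding peeled_def v dominates_del_vert using G by auto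
qed

lemma peeled_erasable_iff:
  assumes "peeled n S G \<theta>"
  shows "erasable G \<theta> x \<longleftrightarrow> erasable_at n S x"
proof -
  have G: "verts G = shifted_shape n - S"
    "\<And>x y. x \<rightarrow>\<^bsub>G\<^esub> y \<longleftrightarrow> x \<in> verts G \<and> y \<in> verts G \<and> y \<in> B_nbrs n x"
    "\<And>x. x \<in> verts G \<Longrightarrow> \<theta> x = B_val n x - card (B_nbrs n x \<inter> S)"
    using assms by (auto simp: peeled_def)
  have "\<theta> z = 0 \<longleftrightarrow> B_val n z \<le> card (B_nbrs n z \<inter> S)"
    "\<theta> z \<noteq> 0 \<longleftrightarrow> card (B_nbrs n z \<inter> S) < B_val n z" if "z \<in> verts G" for z
    using G(3)[OF that] by auto
  then show ?thesis
    unfolding erasable_def erasable_at_def G(2) G(1)[symmetric] by blast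
qed

text \<open>Each erasure removes a vertex. This is needed because \<open>IS\<close> takes prefixes
  of completed sequences only, so a partial run has to be extended to its end.\<close>

lemma peeling_seq_exists:
  "finite (verts G) \<Longrightarrow> \<exists>xs. peeling_seq G \<theta> xs"
proof (induction "card (verts G)" arbitrary: G \<theta> rule: less_induct)
  case less
  show ?case
  proof (cases "\<exists>x. erasable G \<theta> x")
    case True
    then obtain x where x: "erasable G \<theta> x" by blast
    then have "verts (pre_digraph.del_vert G x) \<subset> verts G"
      by (auto simp: pre_digraph.del_vert_def erasable_def)
    then obtain xs where "peeling_seq (pre_digraph.del_vert G x) (peel_val G \<theta> x) xs"
      using less by (metis psubset_card_mono finite_subset psubset_imp_subset)
    with x have "peeling_seq G \<theta> (x # xs)" by (rule peeling_seq.peel)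
    then show ?thesis by blast
  qed (blast intro: peeling_seq.stop)
qed

text \<open>The invariant is that the erased set is the inversion set of a signed permutation: each
  erasure is an ascent, and following it multiplies by a generator.\<close>

lemma peeling_prefix_is_Linv:
  assumes "peeling_seq G \<theta> xs" "w \<in> signed_perms n" "peeled n (Linv n w) G \<theta>"
  shows "\<exists>\<tau>\<in>signed_perms n. Linv n \<tau> = Linv n w \<union> set (take k xs)"
  using assms
proof (induction arbitrary: w k rule: peeling_seq.induct)
  case (peel G \<theta> x xs)
  show ?case
  proof (cases k)
    case 0
    then show ?thesis using peel.prems by auto
  next
    case (Suc k')
    have "erasable_at n (Linv n w) x"
      using peel.hyps(1) peeled_erasable_iff[OF peel.prems(2)] by simp
    then obtain i where i: "i < n" "w (lower_pos i) < w (int i + 1)"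
      "x = shift_rep (w (lower_pos i)) (w (int i + 1))"
      using erasable_at_imp_ascent[OF peel.prems(1)] by blast
    let ?v = "w \<circ> simple_refl i"
    have v: "?v \<in> signed_perms n" "Linv n ?v = insert x (Linv n w)"
      using Linv_comp_simple_refl(1)[OF peel.prems(1) i(1,2)] i
      by (auto intro!: comp_in_signed_perms simple_refl_in_signed_perms peel.prems)
    have "peeled n (Linv n ?v) (pre_digraph.del_vert G x) (peel_val G \<theta> x)"
      unfolding v(2) using peel.prems(2) peel.hyps(1)
      by (intro peeled_peel) (auto simp: erasable_def)
    from peel.IH[OF v(1) this, of k'] show ?thesis unfolding v(2) Suc by simp
  qed
qed auto

text \<open>The ascents that lead from \<open>w\<close> to \<open>\<tau>\<close> inside
  \<open>Linv n \<tau>\<close> are erasable one after the other.\<close>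

lemma Linv_is_peeling_prefix:
  assumes "w \<in> signed_perms n" "\<tau> \<in> signed_perms n" "Linv n w \<subseteq> Linv n \<tau>" "peeled n (Linv n w) G \<theta>"
  shows "\<exists>xs k. peeling_seq G \<theta> xs \<and> k \<le> length xs \<and> Linv n \<tau> = Linv n w \<union> set (take k xs)"
  using assms
proof (induction "card (Linv n \<tau> - Linv n w)" arbitrary: w G \<theta> rule: less_induct)
  case less
  show ?case
  proof (cases "w = \<tau>")
    case True
    have "finite (verts G)"
      using less.prems(4) finite_shifted_shape by (simp add: peeled_def)
    \<comment> \<open>Once \<open>\<tau>\<close> is reached, any completion of the process will do,
      and none of its entries is counted.\<close>
    then obtain xs where "peeling_seq G \<theta> xs" using peeling_seq_exists by blast
    with True show ?thesis by (intro exI[of _ xs] exI[of _ 0]) simp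
  next
    case False
    from Linv_extend[OF less.prems(1-3) False] obtain i where i: "i < n" "w (lower_pos i) < w (int i + 1)"
      and c: "shift_rep (w (lower_pos i)) (w (int i + 1)) \<in> Linv n \<tau>" .
    define x where "x = shift_rep (w (lower_pos i)) (w (int i + 1))"
    let ?v = "w \<circ> simple_refl i"
    have st: "Linv n ?v = insert x (Linv n w)" "x \<notin> Linv n w"
      unfolding x_def using Linv_comp_simple_refl[OF less.prems(1) i] by auto
    have v: "?v \<in> signed_perms n"
      by (intro comp_in_signed_perms simple_refl_in_signed_perms less.prems i)
    have x: "erasable G \<theta> x"
      unfolding peeled_erasable_iff[OF less.prems(4)] x_def
      by (rule erasable_at_ascent[OF less.prems(1) i])
    have pl: "peeled n (Linv n ?v) (pre_digraph.del_vert G x) (peel_val G \<theta> x)"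
      unfolding st using less.prems(4) x by (intro peeled_peel) (auto simp: erasable_def)
    have sub: "Linv n ?v \<subseteq> Linv n \<tau>" using st c less.prems by (auto simp: x_def)
    have "card (Linv n \<tau> - Linv n ?v) < card (Linv n \<tau> - Linv n w)"
      by (rule psubset_card_mono) (use st c x_def finite_Linv in auto)
    from less.hyps[OF this v less.prems(2) sub pl] obtain xs k where
      "peeling_seq (pre_digraph.del_vert G x) (peel_val G \<theta> x) xs" "k \<le> length xs"
      "Linv n \<tau> = Linv n ?v \<union> set (take k xs)"
      by blast
    then show ?thesis
      using x by (intro exI[of _ "x # xs"] exI[of _ "Suc k"]) (auto simp: st intro: peeling_seq.peel)
  qed
qed

section \<open>The isomorphism\<close>

lemma IS_B_eq: "IS (B_digraph n) (B_val n) = Linv n ` signed_perms n"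
proof (intro equalityI subsetI)
  have B: "peeled n (Linv n id) (B_digraph n) (B_val n)" by (simp add: Linv_id peeled_B)
  fix S assume "S \<in> IS (B_digraph n) (B_val n)"
  then consider "S = {}" | k xs where "peeling_seq (B_digraph n) (B_val n) xs" "S = set (take k xs)"
    by (auto simp: IS_def)
  then show "S \<in> Linv n ` signed_perms n"
  proof cases
    case 1
    then show ?thesis using Linv_id id_in_signed_perms by (metis imageI)
  next
    case 2
    then show ?thesis
      using peeling_prefix_is_Linv[OF 2(1) id_in_signed_perms B, of k] by (auto simp: Linv_id)
  qed
next
  have B: "peeled n (Linv n id) (B_digraph n) (B_val n)" by (simp add: Linv_id peeled_B)
  fix S assume "S \<in> Linv n ` signed_perms n"
  then obtain \<tau> where t: "\<tau> \<in> signed_perms n" "S = Linv n \<tau>" by blast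
  from Linv_is_peeling_prefix[OF id_in_signed_perms t(1) _ B] obtain xs k where
    "peeling_seq (B_digraph n) (B_val n) xs" "k \<le> length xs" "S = set (take k xs)"
    by (auto simp: Linv_id t(2))
  then show "S \<in> IS (B_digraph n) (B_val n)"
    \<comment> \<open>For \<open>k = 0\<close> the set is empty, which \<open>IS\<close> contains by
      a separate clause.\<close>
    unfolding IS_def by (cases "k = 0") force+
qed

theorem theorem5:
  fixes n :: nat
  assumes "n \<ge> 1"
  shows "\<exists>f. bij_betw f (signed_perms n) (IS (B_digraph n) (B_val n)) \<and>
             (\<forall>w\<in>signed_perms n. \<forall>\<tau>\<in>signed_perms n. right_weak_le n w \<tau> \<longleftrightarrow> f w \<subseteq> f \<tau>)"
proof (intro exI conjI ballI)
  show "bij_betw (Linv n) (signed_perms n) (IS (B_digraph n) (B_val n))"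
    unfolding IS_B_eq by (auto simp: bij_betw_def inj_on_def intro: Linv_inj)
qed (rule right_weak_le_iff_Linv_subset)

end
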